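(* Let $X$ be a real random variable with $\mathsf E|X|<\infty$, $\mathsf E X=0$ and $\mathsf P(X=0)<1$, and let $m:=\frac12\mathsf E|X|$. Let $g\colon\mathbb R\to\mathbb R$ be any Borel function bounded from below (or from above) such that $g(0)=0$. Then $$\mathsf E g(X)=\int_0^m\mathsf E g(X_h)\,\frac{dh}{\mathsf E X_h^{+}},$$ where $X_h:=X_{x_+(h),x_-(h)}$ is a zero-mean random variable with values in the two-point set $\{x_+(h),x_-(h)\}$.
   Context: Let $\mu$ be the distribution of $X$ (extended to $[-\infty,\infty]$ by $\mu(\{\pm\infty\})=0$). Define $G\colon[-\infty,\infty]\to[0,\infty)$ by $G(x)=\int_{(0,x]}z\,\mu(dz)$ for $x\in[0,\infty]$ and $G(x)=\int_{[x,0)}(-z)\,\mu(dz)$ for $x\in[-\infty,0]$. For $h\in[-\infty,\infty]$ let $x_+(h)=\inf\{x\in[0,\infty]\colon G(x)\ge h\}$ and $x_-(h)=\sup\{x\in[-\infty,0]\colon G(x)\ge h\}$ (with $\inf\emptyset=\infty$, $\sup\emptyset=-\infty$). For $h\in(0,m)$ one has $-\infty<x_-(h)<0<x_+(h)<\infty$. For real $a,b$ with $ab<0$, $X_{a,b}$ denotes a zero-mean random variable with values in $\{a,b\}$: $\mathsf P(X_{a,b}=a)=\frac b{b-a}$, $\mathsf P(X_{a,b}=b)=\frac a{a-b}$. Notation: $x^+:=\max(0,x)$. *)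

theory Defs
  imports "HOL-Probability.Probability"
begin

text \<open>Integrals that may take the values \<open>\<infinity>\<close> or \<open>-\<infinity>\<close>. The value \<open>ext_integral M f\<close> is
  meaningful only if \<open>quasi_integrable M f\<close>: in \<open>ereal\<close> one has \<open>\<infinity> - \<infinity> = \<infinity>\<close>.\<close>

definition quasi_integrable :: "'a measure \<Rightarrow> ('a \<Rightarrow> real) \<Rightarrow> bool" where
  "quasi_integrable M f \<longleftrightarrow> f \<in> borel_measurable M \<and>
     ((\<integral>\<^sup>+ x. ennreal (f x) \<partial>M) < \<infinity> \<or> (\<integral>\<^sup>+ x. ennreal (- f x) \<partial>M) < \<infinity>)"

definition ext_integral :: "'a measure \<Rightarrow> ('a \<Rightarrow> real) \<Rightarrow> ereal" where
  "ext_integral M f =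
     enn2ereal (\<integral>\<^sup>+ x. ennreal (f x) \<partial>M) - enn2ereal (\<integral>\<^sup>+ x. ennreal (- f x) \<partial>M)"

text \<open>The image under \<open>ereal\<close> is the extension that gives \<open>\<infinity>\<close> and \<open>-\<infinity>\<close> mass zero.\<close>

definition ext_measure :: "real measure \<Rightarrow> ereal measure" where
  "ext_measure \<mu> = distr \<mu> borel ereal"

definition G_fun :: "real measure \<Rightarrow> ereal \<Rightarrow> real" where
  "G_fun \<mu> x = (if 0 \<le> x then (LINT z:{0<..x}|ext_measure \<mu>. real_of_ereal z)
                 else (LINT z:{x..<0}|ext_measure \<mu>. - real_of_ereal z))"

definition x_plus :: "real measure \<Rightarrow> ereal \<Rightarrow> ereal" where
  "x_plus \<mu> h = Inf {x. 0 \<le> x \<and> h \<le> ereal (G_fun \<mu> x)}"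

definition x_minus :: "real measure \<Rightarrow> ereal \<Rightarrow> ereal" where
  "x_minus \<mu> h = Sup {x. x \<le> 0 \<and> h \<le> ereal (G_fun \<mu> x)}"

text \<open>The law of \<open>X\<^bsub>a,b\<^esub>\<close>. It is used only for \<open>a * b < 0\<close>, where \<open>b / (b - a)\<close> lies in \<open>(0, 1)\<close>.\<close>

definition two_point_pmf :: "real \<Rightarrow> real \<Rightarrow> real pmf" where
  "two_point_pmf a b = map_pmf (\<lambda>c. if c then a else b) (bernoulli_pmf (b / (b - a)))"

lemma two_point_prob:
  fixes a b :: real
  assumes "a * b < 0"
  shows "0 < b / (b - a)" "b / (b - a) < 1" "a \<noteq> b" "1 - b / (b - a) = a / (a - b)"
proof -
  have "0 < b \<and> a < 0 \<or> b < 0 \<and> 0 < a" using assms by (auto simp: mult_less_0_iff)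
  then show "0 < b / (b - a)" "b / (b - a) < 1" "a \<noteq> b"
    by (auto simp: zero_less_divide_iff divide_less_eq)
  then have "b - a \<noteq> 0" "a - b \<noteq> 0" by auto
  then show "1 - b / (b - a) = a / (a - b)" by (simp add: divide_simps) (simp add: algebra_simps)
qed

lemma two_point_pmf:
  assumes "a * b < 0"
  shows "set_pmf (two_point_pmf a b) = {a, b}"
    and "pmf (two_point_pmf a b) a = b / (b - a)"
    and "pmf (two_point_pmf a b) b = a / (a - b)"
    and "measure_pmf.expectation (two_point_pmf a b) (\<lambda>x. x) = 0"
proof -
  note p = two_point_prob[OF assms]
  have inj: "inj (\<lambda>c. if c then a else b)" using p(3) by (auto simp: inj_def)
  show "set_pmf (two_point_pmf a b) = {a, b}"
    using p by (auto simp: two_point_pmf_def set_pmf_bernoulli UNIV_bool)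
  show "pmf (two_point_pmf a b) a = b / (b - a)"
    using pmf_map_inj'[OF inj, of "bernoulli_pmf (b / (b - a))" True] p
    by (simp add: two_point_pmf_def)
  show "pmf (two_point_pmf a b) b = a / (a - b)"
    using pmf_map_inj'[OF inj, of "bernoulli_pmf (b / (b - a))" False] p
    by (simp add: two_point_pmf_def)
  show "measure_pmf.expectation (two_point_pmf a b) (\<lambda>x. x) = 0"
    using p by (simp add: two_point_pmf_def field_simps)
qed

lemma G_fun_distr:
  assumes [measurable]: "X \<in> borel_measurable M"
  shows "0 \<le> x \<Longrightarrow> G_fun (distr M borel X) x =
           (\<integral>\<omega>. indicator {0<..x} (ereal (X \<omega>)) * X \<omega> \<partial>M)"
    and "x \<le> 0 \<Longrightarrow> G_fun (distr M borel X) x =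
           (\<integral>\<omega>. indicator {x..<0} (ereal (X \<omega>)) * (- X \<omega>) \<partial>M)"
proof -
  have d: "ext_measure (distr M borel X) = distr M borel (\<lambda>\<omega>. ereal (X \<omega>))"
    unfolding ext_measure_def by (subst distr_distr) (auto simp: comp_def)
  have e: "{0<..x} = {}" "{x..<0} = {}" if "x = 0" using that by auto
  show "0 \<le> x \<Longrightarrow> G_fun (distr M borel X) x =
           (\<integral>\<omega>. indicator {0<..x} (ereal (X \<omega>)) * X \<omega> \<partial>M)"
    by (simp add: G_fun_def d set_lebesgue_integral_def integral_distr)
  show "x \<le> 0 \<Longrightarrow> G_fun (distr M borel X) x =
           (\<integral>\<omega>. indicator {x..<0} (ereal (X \<omega>)) * (- X \<omega>) \<partial>M)"
    by (cases "x = 0")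
       (simp_all add: G_fun_def d set_lebesgue_integral_def integral_distr e)
qed

lemma x_plus_bounds:
  fixes X :: "'a \<Rightarrow> real"
  assumes X: "integrable M X" and EX: "(\<integral>\<omega>. X \<omega> \<partial>M) = 0"
    and h: "0 < h" "h < (\<integral>\<omega>. \<bar>X \<omega>\<bar> \<partial>M) / 2"
  shows "0 < x_plus (distr M borel X) (ereal h)" "x_plus (distr M borel X) (ereal h) < \<infinity>"
proof -
  have [measurable]: "X \<in> borel_measurable M" using X by auto
  let ?G = "G_fun (distr M borel X)"
  let ?f = "\<lambda>x \<omega>. indicator {0<..x::ereal} (ereal (X \<omega>)) * X \<omega>"
  have int: "integrable M (?f x)" for x
    by (rule Bochner_Integration.integrable_bound[OF X]) (auto simp: indicator_def)
  have mono: "?G x \<le> ?G y" if "0 \<le> x" "x \<le> y" for x y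
  proof -
    have "(\<integral>\<omega>. ?f x \<omega> \<partial>M) \<le> (\<integral>\<omega>. ?f y \<omega> \<partial>M)"
      by (rule integral_mono[OF int int])
         (use that in \<open>auto simp: indicator_def intro: order_trans\<close>)
    then show ?thesis using that by (simp add: G_fun_distr(1))
  qed
  have "(\<lambda>n. \<integral>\<omega>. ?f (ereal (real n)) \<omega> \<partial>M) \<longlonglongrightarrow> (\<integral>\<omega>. max 0 (X \<omega>) \<partial>M)"
  proof (rule integral_dominated_convergence[where w = "\<lambda>\<omega>. \<bar>X \<omega>\<bar>"])
    show "AE \<omega> in M. (\<lambda>n. ?f (ereal (real n)) \<omega>) \<longlonglongrightarrow> max 0 (X \<omega>)"
    proof (rule AE_I2, rule tendsto_eventually)
      fix \<omega>
      have "\<forall>\<^sub>F n in sequentially. X \<omega> \<le> real n"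
        by (meson eventually_sequentiallyI le_trans of_nat_le_iff order_trans real_arch_simple)
      then show "\<forall>\<^sub>F n in sequentially. ?f (ereal (real n)) \<omega> = max 0 (X \<omega>)"
        by eventually_elim (auto simp: indicator_def)
    qed
  qed (use X in \<open>auto simp: indicator_def\<close>)
  moreover have "(\<integral>\<omega>. max 0 (X \<omega>) \<partial>M) = (\<integral>\<omega>. (\<bar>X \<omega>\<bar> + X \<omega>) / 2 \<partial>M)"
    by (rule Bochner_Integration.integral_cong) (auto simp: max_def)
  then have "(\<integral>\<omega>. max 0 (X \<omega>) \<partial>M) = (\<integral>\<omega>. \<bar>X \<omega>\<bar> \<partial>M) / 2"
    using X EX by simp
  ultimately have "(\<lambda>n. \<integral>\<omega>. ?f (ereal (real n)) \<omega> \<partial>M) \<longlonglongrightarrow> (\<integral>\<omega>. \<bar>X \<omega>\<bar> \<partial>M) / 2"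
    by (simp only:)
  then have "\<forall>\<^sub>F n in sequentially. h < (\<integral>\<omega>. ?f (ereal (real n)) \<omega> \<partial>M)"
    using h(2) by (rule order_tendstoD(1))
  then obtain n where "h < ?G (ereal (real n))"
    by (auto simp: G_fun_distr(1) eventually_sequentially)
  then have "x_plus (distr M borel X) (ereal h) \<le> ereal (real n)"
    unfolding x_plus_def by (intro Inf_lower) auto
  then show "x_plus (distr M borel X) (ereal h) < \<infinity>"
    by (auto simp: less_top[symmetric])
  have "(\<lambda>n. \<integral>\<omega>. ?f (ereal (inverse (real (Suc n)))) \<omega> \<partial>M) \<longlonglongrightarrow> (\<integral>\<omega>. 0 \<partial>M)"
  proof (rule integral_dominated_convergence[where w = "\<lambda>\<omega>. \<bar>X \<omega>\<bar>"])
    show "AE \<omega> in M. (\<lambda>n. ?f (ereal (inverse (real (Suc n)))) \<omega>) \<longlonglongrightarrow> 0"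
    proof (rule AE_I2)
      fix \<omega>
      show "(\<lambda>n. ?f (ereal (inverse (real (Suc n)))) \<omega>) \<longlonglongrightarrow> 0"
        by (rule tendsto_sandwich[OF _ _ tendsto_const LIMSEQ_inverse_real_of_nat])
           (auto simp: indicator_def)
    qed
  qed (use X in \<open>auto simp: indicator_def\<close>)
  then have "\<forall>\<^sub>F n in sequentially. (\<integral>\<omega>. ?f (ereal (inverse (real (Suc n)))) \<omega> \<partial>M) < h"
    by (rule order_tendstoD(2)) (simp add: h)
  then obtain n where n: "?G (ereal (inverse (real (Suc n)))) < h"
    by (auto simp: G_fun_distr(1) eventually_sequentially)
  have "ereal (inverse (real (Suc n))) \<le> x_plus (distr M borel X) (ereal h)"
    unfolding x_plus_def
  proof (rule Inf_greatest)
    fix x assume x: "x \<in> {x. 0 \<le> x \<and> ereal h \<le> ereal (?G x)}"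
    show "ereal (inverse (real (Suc n))) \<le> x"
    proof (rule ccontr)
      assume "\<not> ?thesis"
      then have "?G x \<le> ?G (ereal (inverse (real (Suc n))))" using x by (intro mono) auto
      then show False using x n by auto
    qed
  qed
  moreover have "0 < ereal (inverse (real (Suc n)))" by simp
  ultimately show "0 < x_plus (distr M borel X) (ereal h)" by (rule less_le_trans[rotated])
qed

lemma x_minus_conv_x_plus:
  fixes X :: "'a \<Rightarrow> real"
  assumes [measurable]: "X \<in> borel_measurable M"
  shows "x_minus (distr M borel X) h = - x_plus (distr M borel (\<lambda>\<omega>. - X \<omega>)) h"
proof -
  have G: "G_fun (distr M borel (\<lambda>\<omega>. - X \<omega>)) x = G_fun (distr M borel X) (- x)" if "0 \<le> x" for x
  proof -
    have "indicator {0<..x} (ereal (- X \<omega>)) = (indicator {-x..<0} (ereal (X \<omega>)) :: real)" for \<omega>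
      by (cases x) (auto simp: indicator_def)
    then show ?thesis using that by (simp add: G_fun_distr)
  qed
  have "{x. x \<le> 0 \<and> h \<le> ereal (G_fun (distr M borel X) x)} =
        uminus ` {x. 0 \<le> x \<and> h \<le> ereal (G_fun (distr M borel (\<lambda>\<omega>. - X \<omega>)) x)}"
    (is "?A = uminus ` ?B")
  proof (intro set_eqI iffI)
    fix x assume "x \<in> ?A"
    then have "- x \<in> ?B" using G[of "- x"] by auto
    then show "x \<in> uminus ` ?B" by (metis ereal_uminus_uminus image_eqI)
  qed (auto simp: G)
  then show ?thesis
    by (simp add: x_minus_def x_plus_def ereal_Sup_uminus_image_eq)
qed

lemma x_minus_bounds:
  fixes X :: "'a \<Rightarrow> real"
  assumes X: "integrable M X" and EX: "(\<integral>\<omega>. X \<omega> \<partial>M) = 0"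
    and h: "0 < h" "h < (\<integral>\<omega>. \<bar>X \<omega>\<bar> \<partial>M) / 2"
  shows "- \<infinity> < x_minus (distr M borel X) (ereal h)" "x_minus (distr M borel X) (ereal h) < 0"
  using x_plus_bounds[of M "\<lambda>\<omega>. - X \<omega>" h] X EX h
  by (simp_all add: x_minus_conv_x_plus ereal_uminus_less_reorder ereal_less_uminus_reorder)

text \<open>By \<open>x_plus_bounds\<close> and \<open>x_minus_bounds\<close>, for \<open>0 < h < m\<close> the two values below are finite
  and of opposite sign, so the conversions to \<open>real\<close> lose nothing.\<close>

definition X_law :: "real measure \<Rightarrow> real \<Rightarrow> real pmf" where
  "X_law \<mu> h = two_point_pmf (real_of_ereal (x_plus \<mu> (ereal h))) (real_of_ereal (x_minus \<mu> (ereal h)))"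

end

theory Submission
  imports Defs
begin

text \<open>Writing out the two-point law gives
  \<open>E g(X\<^sub>h) / E X\<^sub>h\<^sup>+ = g(x\<^sub>+(h)) / x\<^sub>+(h) + g(x\<^sub>-(h)) / \<bar>x\<^sub>-(h)\<bar>\<close>. Since \<open>G\<close> is right-continuous on
  \<open>[0, \<infinity>]\<close>, one has \<open>x\<^sub>+(h) \<le> x\<close> iff \<open>h \<le> G(x)\<close>, so \<open>x\<^sub>+\<close> pushes Lebesgue measure on \<open>(0, m)\<close>
  forward to \<open>z \<mu>(dz)\<close> on the positive half line; integrating \<open>g(z) / z\<close> against it gives
  \<open>E g(X) 1{X > 0}\<close>. The negative half line is the same statement for \<open>- X\<close>. The positive and
  negative parts of \<open>g\<close> are treated separately, the semibounded one having a finite integral.\<close>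

section \<open>Extended integrals of differences, and two-point laws\<close>

text \<open>Pointwise \<open>f\<^sup>+ + n = f\<^sup>- + p\<close>; integrate and rearrange. As
  \<open>f\<^sup>+ \<le> p\<close> and \<open>f\<^sup>- \<le> n\<close>, finiteness passes from
  \<open>p\<close> or \<open>n\<close> to \<open>f\<close>. The functions \<open>p\<close> and
  \<open>n\<close> may be positive at the same point; the integrand in \<open>h\<close> needs this,
  since \<open>g\<close> can have opposite signs at the two values of the law.\<close>

lemma ext_integral_diff:
  fixes f p n :: "'a \<Rightarrow> real"
  assumes [measurable]: "f \<in> borel_measurable M" "p \<in> borel_measurable M" "n \<in> borel_measurable M"
    and f: "\<And>x. x \<in> space M \<Longrightarrow> f x = p x - n x"
    and p: "\<And>x. x \<in> space M \<Longrightarrow> 0 \<le> p x" and n: "\<And>x. x \<in> space M \<Longrightarrow> 0 \<le> n x"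
    and fin: "(\<integral>\<^sup>+x. p x \<partial>M) < \<infinity> \<or> (\<integral>\<^sup>+x. n x \<partial>M) < \<infinity>"
  shows "quasi_integrable M f"
    and "ext_integral M f = enn2ereal (\<integral>\<^sup>+x. p x \<partial>M) - enn2ereal (\<integral>\<^sup>+x. n x \<partial>M)"
proof -
  have le: "(\<integral>\<^sup>+x. f x \<partial>M) \<le> (\<integral>\<^sup>+x. p x \<partial>M)" "(\<integral>\<^sup>+x. - f x \<partial>M) \<le> (\<integral>\<^sup>+x. n x \<partial>M)"
    using f p n by (auto intro!: nn_integral_mono ennreal_leI)
  then show "quasi_integrable M f"
    using fin by (auto simp: quasi_integrable_def intro: le_less_trans)
  have "(\<integral>\<^sup>+x. f x \<partial>M) + (\<integral>\<^sup>+x. n x \<partial>M) = (\<integral>\<^sup>+x. ennreal (f x) + ennreal (n x) \<partial>M)"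
    by (simp add: nn_integral_add)
  also have "\<dots> = (\<integral>\<^sup>+x. ennreal (- f x) + ennreal (p x) \<partial>M)"
  proof (rule nn_integral_cong)
    fix x assume x: "x \<in> space M"
    show "ennreal (f x) + ennreal (n x) = ennreal (- f x) + ennreal (p x)"
      using f[OF x] p[OF x] n[OF x]
      by (cases "0 \<le> f x") (simp_all add: ennreal_neg flip: ennreal_plus)
  qed
  also have "\<dots> = (\<integral>\<^sup>+x. - f x \<partial>M) + (\<integral>\<^sup>+x. p x \<partial>M)"
    by (simp add: nn_integral_add)
  finally have eq: "(\<integral>\<^sup>+x. f x \<partial>M) + (\<integral>\<^sup>+x. n x \<partial>M) = (\<integral>\<^sup>+x. - f x \<partial>M) + (\<integral>\<^sup>+x. p x \<partial>M)" .
  \<comment> \<open>Rearranging stays valid with infinite terms: if \<open>P\<close> is finite, so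
    is \<open>A\<close>, and \<open>N = \<infinity>\<close> then forces
    \<open>B = \<infinity>\<close>. The case of finite \<open>N\<close> is symmetric.\<close>
  have "enn2ereal A - enn2ereal B = enn2ereal P - enn2ereal N"
    if "A + N = B + P" "A \<le> P" "B \<le> N" "P < \<infinity> \<or> N < \<infinity>" for A B P N :: ennreal
    using that
    by (cases A; cases B; cases P; cases N) (auto simp: top_unique simp flip: ennreal_plus)
  from this[OF eq le fin]
  show "ext_integral M f = enn2ereal (\<integral>\<^sup>+x. p x \<partial>M) - enn2ereal (\<integral>\<^sup>+x. n x \<partial>M)"
    by (simp add: ext_integral_def)
qed

text \<open>With \<open>q\<close> the mass at \<open>a\<close>, the only positive value, the
  denominator is \<open>a * q\<close>. Zero mean says \<open>a * q = - b * (1 - q)\<close>, so the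
  division cancels the probability in each term of the numerator.\<close>

lemma two_point_expectation_ratio:
  assumes "0 < a" "b < 0"
  shows "measure_pmf.expectation (two_point_pmf a b) g
       / measure_pmf.expectation (two_point_pmf a b) (\<lambda>x. max 0 x) = g a / a + g b / - b"
proof -
  have "a * b < 0"
    using assms by (simp add: mult_pos_neg)
  note p = two_point_prob[OF this]
  define q where "q = b / (b - a)"
  have "(1 - q) / (a * q) = 1 / - b"
    unfolding q_def p(4) using assms by (simp add: divide_simps)
  moreover have "(g a * q + g b * (1 - q)) / (a * q) = g a / a + g b * ((1 - q) / (a * q))"
    using p(1) assms by (simp add: add_divide_distrib flip: q_def)
  ultimately show ?thesis
    using p(1,2) assms by (simp add: two_point_pmf_def max_def flip: q_def)
qed

section \<open>The function \<open>G\<close> on the positive half line and its generalized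
  inverse\<close>

context
  fixes M :: "'a measure" and X :: "'a \<Rightarrow> real"
  assumes X: "integrable M X"
begin

abbreviation (input) truncated_pos :: "real \<Rightarrow> 'a \<Rightarrow> real" where
  "truncated_pos x \<omega> \<equiv> indicator {0<..ereal x} (ereal (X \<omega>)) * X \<omega>"

lemma X_measurable [measurable]: "X \<in> borel_measurable M"
  using X by auto

lemma integrable_truncated_pos: "integrable M (truncated_pos x)"
  by (rule Bochner_Integration.integrable_bound[OF X]) (auto simp: indicator_def)

text \<open>The arguments are extended reals, because \<open>x_plus_le_iff\<close> applies this to a
  point of the set whose infimum defines \<open>x_plus\<close>.\<close>

lemma G_fun_nonneg_mono:
  assumes "0 \<le> x" "x \<le> y"
  shows "G_fun (distr M borel X) x \<le> G_fun (distr M borel X) y"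
proof -
  have int: "integrable M (\<lambda>\<omega>. indicator {0<..z::ereal} (ereal (X \<omega>)) * X \<omega>)" for z
    by (rule Bochner_Integration.integrable_bound[OF X]) (auto simp: indicator_def)
  have "(\<integral>\<omega>. indicator {0<..x} (ereal (X \<omega>)) * X \<omega> \<partial>M)
      \<le> (\<integral>\<omega>. indicator {0<..y} (ereal (X \<omega>)) * X \<omega> \<partial>M)"
    by (rule integral_mono[OF int int])
       (use assms in \<open>auto simp: indicator_def intro: order_trans\<close>)
  then show ?thesis
    using assms by (simp add: G_fun_distr(1))
qed

text \<open>The interval in \<open>G\<close> is closed on the right. Hence the integrands are
  eventually constant in \<open>n\<close>: if \<open>X \<omega> \<le> x\<close> they all agree,
  otherwise \<open>X \<omega>\<close> eventually lies beyond the truncation point. The dominating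
  function is \<open>\<bar>X \<omega>\<bar>\<close>.\<close>

lemma G_fun_right_limit:
  assumes "0 \<le> x"
  shows "(\<lambda>n. G_fun (distr M borel X) (ereal (x + inverse (real (Suc n)))))
           \<longlonglongrightarrow> G_fun (distr M borel X) (ereal x)"
proof -
  have "(\<lambda>n. \<integral>\<omega>. truncated_pos (x + inverse (real (Suc n))) \<omega> \<partial>M)
          \<longlonglongrightarrow> (\<integral>\<omega>. truncated_pos x \<omega> \<partial>M)"
  proof (rule integral_dominated_convergence[where w = "\<lambda>\<omega>. \<bar>X \<omega>\<bar>"])
    show "AE \<omega> in M. (\<lambda>n. truncated_pos (x + inverse (real (Suc n))) \<omega>)
            \<longlonglongrightarrow> truncated_pos x \<omega>"
    proof (rule AE_I2, rule tendsto_eventually)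
      fix \<omega>
      show "\<forall>\<^sub>F n in sequentially.
              truncated_pos (x + inverse (real (Suc n))) \<omega> = truncated_pos x \<omega>"
      proof (cases "X \<omega> \<le> x")
        case True
        then show ?thesis
          by (intro always_eventually allI) (auto simp: indicator_def intro: order_trans)
      next
        case False
        then have "\<forall>\<^sub>F n in sequentially. inverse (real (Suc n)) < X \<omega> - x"
          using LIMSEQ_inverse_real_of_nat by (intro order_tendstoD(2)[where y = 0]) auto
        then show ?thesis
          by eventually_elim (use False in \<open>auto simp: indicator_def\<close>)
      qed
    qed
  qed (use X in \<open>auto simp: indicator_def\<close>)
  then show ?thesis
    using assms by (simp add: G_fun_distr(1) add_nonneg_nonneg)
qed

text \<open>From left to right: any point strictly beyond the infimum has a member of the defining
  set below it, so \<open>h \<le> G\<close> holds there by monotonicity; right-continuity carries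
  the bound down to \<open>x\<close>.\<close>

lemma x_plus_le_iff:
  assumes "0 \<le> x"
  shows "x_plus (distr M borel X) (ereal h) \<le> ereal x \<longleftrightarrow> h \<le> G_fun (distr M borel X) (ereal x)"
proof
  assume "h \<le> G_fun (distr M borel X) (ereal x)"
  then show "x_plus (distr M borel X) (ereal h) \<le> ereal x"
    unfolding x_plus_def using assms by (intro Inf_lower) auto
next
  assume le: "x_plus (distr M borel X) (ereal h) \<le> ereal x"
  show "h \<le> G_fun (distr M borel X) (ereal x)"
  proof (rule LIMSEQ_le_const[OF G_fun_right_limit[OF assms]], intro exI allI impI)
    fix n :: nat
    have "x_plus (distr M borel X) (ereal h) < ereal (x + inverse (real (Suc n)))"
      using le by (rule le_less_trans) simp
    then obtain y where y: "0 \<le> y" "h \<le> G_fun (distr M borel X) y"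
        "y < ereal (x + inverse (real (Suc n)))"
      unfolding x_plus_def Inf_less_iff by auto
    show "h \<le> G_fun (distr M borel X) (ereal (x + inverse (real (Suc n))))"
      using y(2) G_fun_nonneg_mono[OF y(1) less_imp_le[OF y(3)]] by (rule order_trans)
  qed
qed

text \<open>This is the mass that \<open>z \<mu>(dz)\<close> gives to the ray beyond
  \<open>x\<close>. The tail is the positive part of \<open>X\<close> minus its truncation at
  \<open>x\<close>, and both are integrable.\<close>

lemma nn_integral_tail:
  assumes "0 \<le> x"
  shows "(\<integral>\<^sup>+\<omega>. ennreal (X \<omega>) * indicator {x<..} (X \<omega>) \<partial>M)
       = ennreal ((\<integral>\<omega>. max 0 (X \<omega>) \<partial>M) - G_fun (distr M borel X) (ereal x))"
proof -
  have int: "integrable M (\<lambda>\<omega>. max 0 (X \<omega>))"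
    using X by auto
  have "(\<integral>\<^sup>+\<omega>. ennreal (X \<omega>) * indicator {x<..} (X \<omega>) \<partial>M)
      = (\<integral>\<^sup>+\<omega>. ennreal (max 0 (X \<omega>) - truncated_pos x \<omega>) \<partial>M)"
    using assms by (intro nn_integral_cong) (auto simp: indicator_def max_def ennreal_neg)
  also have "\<dots> = ennreal (\<integral>\<omega>. max 0 (X \<omega>) - truncated_pos x \<omega> \<partial>M)"
    using int integrable_truncated_pos
    by (intro nn_integral_eq_integral Bochner_Integration.integrable_diff)
       (auto simp: indicator_def)
  also have "(\<integral>\<omega>. max 0 (X \<omega>) - truncated_pos x \<omega> \<partial>M)
      = (\<integral>\<omega>. max 0 (X \<omega>) \<partial>M) - G_fun (distr M borel X) (ereal x)"
    using int integrable_truncated_pos assms by (simp add: G_fun_distr(1))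
  finally show ?thesis .
qed

text \<open>Once the upper bound is known to be \<open>m\<close>, these bounds make
  \<open>(G(x), m)\<close> a subinterval of \<open>(0, m)\<close> of length
  \<open>m - G(x)\<close>.\<close>

lemma G_fun_bounds:
  assumes "0 \<le> x"
  shows "0 \<le> G_fun (distr M borel X) (ereal x)"
    and "G_fun (distr M borel X) (ereal x) \<le> (\<integral>\<omega>. max 0 (X \<omega>) \<partial>M)"
proof -
  show "0 \<le> G_fun (distr M borel X) (ereal x)"
    using assms by (simp add: G_fun_distr(1)) (auto intro!: integral_nonneg_AE simp: indicator_def)
  have "(\<integral>\<omega>. truncated_pos x \<omega> \<partial>M) \<le> (\<integral>\<omega>. max 0 (X \<omega>) \<partial>M)"
    by (rule integral_mono[OF integrable_truncated_pos]) (use X in \<open>auto simp: indicator_def\<close>)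
  then show "G_fun (distr M borel X) (ereal x) \<le> (\<integral>\<omega>. max 0 (X \<omega>) \<partial>M)"
    using assms by (simp add: G_fun_distr(1))
qed

section \<open>Lebesgue measure pushed forward by \<open>x_plus\<close>\<close>

context
  fixes m :: real
  assumes EX: "(\<integral>\<omega>. X \<omega> \<partial>M) = 0" and m: "m = (\<integral>\<omega>. \<bar>X \<omega>\<bar> \<partial>M) / 2"
begin

text \<open>Zero mean splits \<open>E \<bar>X\<bar>\<close> evenly between the two half lines, so
  \<open>z \<mu>(dz)\<close> on the positive one has total mass \<open>m\<close>, the length of the
  range of \<open>h\<close>.\<close>

lemma integral_pos_part: "(\<integral>\<omega>. max 0 (X \<omega>) \<partial>M) = m"
proof -
  have "(\<integral>\<omega>. max 0 (X \<omega>) \<partial>M) = (\<integral>\<omega>. (\<bar>X \<omega>\<bar> + X \<omega>) / 2 \<partial>M)"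
    by (rule Bochner_Integration.integral_cong) (auto simp: max_def)
  then show ?thesis
    using X EX m by simp
qed

lemma x_plus_real:
  assumes "0 < h" "h < m"
  shows "ereal (real_of_ereal (x_plus (distr M borel X) (ereal h))) = x_plus (distr M borel X) (ereal h)"
    and "0 < real_of_ereal (x_plus (distr M borel X) (ereal h))"
  using x_plus_bounds[OF X EX assms(1) assms(2)[unfolded m]]
  by (cases "x_plus (distr M borel X) (ereal h)"; simp)+

text \<open>For \<open>x < 0\<close> the value of \<open>G_fun\<close> is an integral over the left
  half line and says nothing about \<open>x_plus\<close>; there positivity of \<open>x_plus\<close>
  decides.\<close>

lemma less_x_plus_real_iff:
  assumes "0 < h" "h < m"
  shows "x < real_of_ereal (x_plus (distr M borel X) (ereal h))
     \<longleftrightarrow> x < 0 \<or> G_fun (distr M borel X) (ereal x) < h"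
proof (cases "x < 0")
  case False
  then have "real_of_ereal (x_plus (distr M borel X) (ereal h)) \<le> x
      \<longleftrightarrow> h \<le> G_fun (distr M borel X) (ereal x)"
    using x_plus_le_iff[of x h] x_plus_real(1)[OF assms] by (metis ereal_less_eq(3) not_le)
  then show ?thesis
    using False by auto
qed (use x_plus_real(2)[OF assms] in auto)

text \<open>The superlevel sets are intervals, which yields both the measurability of
  \<open>x_plus\<close> and their Lebesgue measure.\<close>

lemma x_plus_vimage:
  "{h \<in> {0<..<m}. x < real_of_ereal (x_plus (distr M borel X) (ereal h))}
     = (if x < 0 then {0<..<m} else {G_fun (distr M borel X) (ereal x)<..<m})"
  using less_x_plus_real_iff[of _ x] G_fun_bounds(1)[of x] by auto

lemma x_plus_measurable:
  "(\<lambda>h. real_of_ereal (x_plus (distr M borel X) (ereal h)))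
     \<in> borel_measurable (restrict_space lborel {0<..<m})"
  unfolding borel_measurable_iff_greater
proof
  fix x
  have "{h \<in> {0<..<m}. x < real_of_ereal (x_plus (distr M borel X) (ereal h))} \<in> sets borel"
    unfolding x_plus_vimage by simp
  then show "{h \<in> space (restrict_space lborel {0<..<m}).
      x < real_of_ereal (x_plus (distr M borel X) (ereal h))}
        \<in> sets (restrict_space lborel {0<..<m})"
    by (subst sets_restrict_space_iff) (auto simp: space_restrict_space)
qed

text \<open>Both measures give the ray \<open>{x<..}\<close> the finite mass
  \<open>m - G(x)\<close>, or \<open>m\<close> if \<open>x < 0\<close>, and such rays determine the
  measure.\<close>

lemma distr_x_plus:
  "distr (restrict_space lborel {0<..<m}) borel (\<lambda>h. real_of_ereal (x_plus (distr M borel X) (ereal h)))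
     = distr (density M (\<lambda>\<omega>. ennreal (X \<omega>))) borel X" (is "?L = ?R")
proof (rule measure_eqI_lessThan)
  fix x :: real
  have "emeasure ?L {x<..}
      = emeasure lborel {h \<in> {0<..<m}. x < real_of_ereal (x_plus (distr M borel X) (ereal h))}"
    by (subst emeasure_distr[OF x_plus_measurable])
       (auto simp: emeasure_restrict_space space_restrict_space intro!: arg_cong[where f = "emeasure lborel"])
  also have "\<dots> = ennreal (m - (if x < 0 then 0 else G_fun (distr M borel X) (ereal x)))"
    unfolding x_plus_vimage using G_fun_bounds(2)[of x] G_fun_bounds[of 0] integral_pos_part by auto
  finally have L: "emeasure ?L {x<..} = \<dots>" .
  \<comment> \<open>\<open>ennreal\<close> sends negative numbers to 0, so the density vanishes
    where \<open>X \<le> 0\<close> and the ray may start at \<open>max 0 x\<close>. For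
    \<open>x < 0\<close> this leads to \<open>G(0)\<close>, which is 0 because the interval is
    empty.\<close>
  have "emeasure ?R {x<..} = (\<integral>\<^sup>+\<omega>. ennreal (X \<omega>) * indicator {max 0 x<..} (X \<omega>) \<partial>M)"
    by (auto simp: emeasure_distr emeasure_density indicator_def ennreal_neg intro!: nn_integral_cong)
  also have "\<dots> = ennreal (m - (if x < 0 then 0 else G_fun (distr M borel X) (ereal x)))"
    using G_fun_distr(1)[OF X_measurable, of 0]
    by (subst nn_integral_tail) (auto simp: integral_pos_part max_absorb1 max_absorb2 not_less zero_ereal_def[symmetric])
  finally show "emeasure ?L {x<..} = emeasure ?R {x<..}"
    using L by simp
  show "emeasure ?L {x<..} < \<infinity>"
    using L by simp
qed simp_all

lemma nn_integral_x_plus: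
  assumes [measurable]: "f \<in> borel_measurable borel"
  shows "(\<integral>\<^sup>+h. f (real_of_ereal (x_plus (distr M borel X) (ereal h))) \<partial>restrict_space lborel {0<..<m})
       = (\<integral>\<^sup>+\<omega>. ennreal (X \<omega>) * f (X \<omega>) \<partial>M)"
  using arg_cong[OF distr_x_plus, of "\<lambda>N. nn_integral N f"]
  by (simp add: nn_integral_distr x_plus_measurable nn_integral_density)

text \<open>The divisor cancels the density \<open>X\<close> where \<open>X > 0\<close>. Elsewhere
  the factor \<open>ennreal (X \<omega>)\<close> is 0, whatever the quotient is, and this produces
  the indicator.\<close>

lemma nn_integral_div_x_plus:
  assumes [measurable]: "f \<in> borel_measurable borel"
  shows "(\<integral>\<^sup>+h. ennreal (f (real_of_ereal (x_plus (distr M borel X) (ereal h)))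
                      / real_of_ereal (x_plus (distr M borel X) (ereal h)))
            \<partial>restrict_space lborel {0<..<m})
       = (\<integral>\<^sup>+\<omega>. ennreal (f (X \<omega>)) * indicator {0<..} (X \<omega>) \<partial>M)"
proof -
  have "ennreal x * ennreal (f x / x) = ennreal (f x) * indicator {0<..} x" for x
    by (cases "0 < x") (auto simp: ennreal_neg simp flip: ennreal_mult')
  then show ?thesis
    using nn_integral_x_plus[of "\<lambda>x. ennreal (f x / x)"] by simp
qed

end

end

section \<open>The negative half line by reflection, and the two half lines combined\<close>

context
  fixes M :: "'a measure" and X :: "'a \<Rightarrow> real" and m :: real
  assumes X: "integrable M X" and EX: "(\<integral>\<omega>. X \<omega> \<partial>M) = 0"
    and m: "m = (\<integral>\<omega>. \<bar>X \<omega>\<bar> \<partial>M) / 2"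
begin

lemma real_x_minus_conv_x_plus:
  "real_of_ereal (x_minus (distr M borel X) h)
     = - real_of_ereal (x_plus (distr M borel (\<lambda>\<omega>. - X \<omega>)) h)"
  using X by (simp add: x_minus_conv_x_plus)

text \<open>Reflection preserves all assumptions and keeps the same \<open>m\<close>, so each result
  on \<open>x_plus\<close> transfers to \<open>x_minus\<close> over the same range of
  \<open>h\<close>.\<close>

lemma neg_X: "integrable M (\<lambda>\<omega>. - X \<omega>)" "(\<integral>\<omega>. - X \<omega> \<partial>M) = 0" "m = (\<integral>\<omega>. \<bar>- X \<omega>\<bar> \<partial>M) / 2"
  using X EX m by simp_all

lemma x_minus_real_neg:
  assumes "0 < h" "h < m"
  shows "real_of_ereal (x_minus (distr M borel X) (ereal h)) < 0"
  using x_plus_real(2)[OF neg_X assms] by (simp add: real_x_minus_conv_x_plus)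

lemma x_minus_measurable:
  "(\<lambda>h. real_of_ereal (x_minus (distr M borel X) (ereal h)))
     \<in> borel_measurable (restrict_space lborel {0<..<m})"
  using x_plus_measurable[OF neg_X] by (simp add: real_x_minus_conv_x_plus)

lemma nn_integral_div_x_minus:
  assumes [measurable]: "f \<in> borel_measurable borel"
  shows "(\<integral>\<^sup>+h. ennreal (f (real_of_ereal (x_minus (distr M borel X) (ereal h)))
                      / - real_of_ereal (x_minus (distr M borel X) (ereal h)))
            \<partial>restrict_space lborel {0<..<m})
       = (\<integral>\<^sup>+\<omega>. ennreal (f (X \<omega>)) * indicator {..<0} (X \<omega>) \<partial>M)"
proof -
  have "indicator {0<..} (- x) = (indicator {..<0} x :: ennreal)" for x :: real
    by (auto simp: indicator_def)
  then show ?thesis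
    using nn_integral_div_x_plus[OF neg_X, of "\<lambda>x. f (- x)"] by (simp add: real_x_minus_conv_x_plus)
qed

text \<open>Nonnegativity lets the integral be split into the two half-line formulas. Together they
  miss only the event \<open>X = 0\<close>, where \<open>f 0 = 0\<close> makes the integrand
  vanish.\<close>

lemma nn_integral_two_sided:
  fixes f :: "real \<Rightarrow> real"
  assumes [measurable]: "f \<in> borel_measurable borel" and nonneg: "\<And>x. 0 \<le> f x" and "f 0 = 0"
  defines "a \<equiv> \<lambda>h. real_of_ereal (x_plus (distr M borel X) (ereal h))"
    and "b \<equiv> \<lambda>h. real_of_ereal (x_minus (distr M borel X) (ereal h))"
  shows "(\<integral>\<^sup>+h. ennreal (f (a h) / a h + f (b h) / - b h) \<partial>restrict_space lborel {0<..<m})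
       = (\<integral>\<^sup>+\<omega>. ennreal (f (X \<omega>)) \<partial>M)"
proof -
  let ?R = "restrict_space lborel {0<..<m}"
  have [measurable]: "X \<in> borel_measurable M"
    using X by auto
  have [measurable]: "a \<in> borel_measurable ?R" "b \<in> borel_measurable ?R"
    unfolding a_def b_def by (rule x_plus_measurable[OF X EX m] x_minus_measurable)+
  have "(\<integral>\<^sup>+h. ennreal (f (a h) / a h + f (b h) / - b h) \<partial>?R)
      = (\<integral>\<^sup>+h. ennreal (f (a h) / a h) + ennreal (f (b h) / - b h) \<partial>?R)"
  proof (rule nn_integral_cong)
    fix h assume "h \<in> space ?R"
    then have "0 < h" "h < m"
      by (auto simp: space_restrict_space)
    then have "0 < a h" "b h < 0"
      using x_plus_real(2)[OF X EX m] x_minus_real_neg by (auto simp: a_def b_def)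
    then show "ennreal (f (a h) / a h + f (b h) / - b h)
        = ennreal (f (a h) / a h) + ennreal (f (b h) / - b h)"
      using nonneg by (intro ennreal_plus divide_nonneg_pos) auto
  qed
  also have "\<dots> = (\<integral>\<^sup>+h. ennreal (f (a h) / a h) \<partial>?R) + (\<integral>\<^sup>+h. ennreal (f (b h) / - b h) \<partial>?R)"
    by (intro nn_integral_add) measurable
  also have "\<dots> = (\<integral>\<^sup>+\<omega>. ennreal (f (X \<omega>)) * indicator {0<..} (X \<omega>) \<partial>M)
      + (\<integral>\<^sup>+\<omega>. ennreal (f (X \<omega>)) * indicator {..<0} (X \<omega>) \<partial>M)"
    by (simp only: a_def b_def nn_integral_div_x_plus[OF X EX m assms(1)]
          nn_integral_div_x_minus[OF assms(1)])
  also have "\<dots> = (\<integral>\<^sup>+\<omega>. ennreal (f (X \<omega>)) * indicator {0<..} (X \<omega>)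
      + ennreal (f (X \<omega>)) * indicator {..<0} (X \<omega>) \<partial>M)"
    by (intro nn_integral_add[symmetric]) measurable
  also have "\<dots> = (\<integral>\<^sup>+\<omega>. ennreal (f (X \<omega>)) \<partial>M)"
    using \<open>f 0 = 0\<close>
    by (intro nn_integral_cong) (auto simp: indicator_def not_less dest: antisym)
  finally show ?thesis .
qed

end

section \<open>Passage from nonnegative to semibounded \<open>g\<close>\<close>

theorem proposition3p18:
  fixes M :: "'a measure" and X :: "'a \<Rightarrow> real" and g :: "real \<Rightarrow> real" and m :: real
  assumes "prob_space M"
    and "X \<in> borel_measurable M"
    and "integrable M X"
    and "(\<integral>\<omega>. X \<omega> \<partial>M) = 0"
    and "measure M {\<omega> \<in> space M. X \<omega> = 0} < 1"
    and "m = (1 / 2) * (\<integral>\<omega>. \<bar>X \<omega>\<bar> \<partial>M)"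
    and "g \<in> borel_measurable borel"
    and "bdd_below (range g) \<or> bdd_above (range g)"
    and "g 0 = 0"
  shows "let I = (\<lambda>h. measure_pmf.expectation (X_law (distr M borel X) h) g
                    / measure_pmf.expectation (X_law (distr M borel X) h) (\<lambda>x. max 0 x))
         in quasi_integrable M (\<lambda>\<omega>. g (X \<omega>))
          \<and> quasi_integrable (restrict_space lborel {0<..<m}) I
          \<and> ext_integral M (\<lambda>\<omega>. g (X \<omega>)) = ext_integral (restrict_space lborel {0<..<m}) I"
proof -
  interpret prob_space M by (fact assms(1))
  note X = assms(3) and EX = assms(4)
  have m: "m = (\<integral>\<omega>. \<bar>X \<omega>\<bar> \<partial>M) / 2"
    using assms(6) by simp
  note [measurable] = assms(2,7)
  let ?R = "restrict_space lborel {0<..<m}"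
  define a where "a h = real_of_ereal (x_plus (distr M borel X) (ereal h))" for h
  define b where "b h = real_of_ereal (x_minus (distr M borel X) (ereal h))" for h
  define I where "I h = measure_pmf.expectation (X_law (distr M borel X) h) g
      / measure_pmf.expectation (X_law (distr M borel X) h) (\<lambda>x. max 0 x)" for h
  define p n where "p x = max 0 (g x)" and "n x = max 0 (- g x)" for x
  \<comment> \<open>The ratio is linear in \<open>g\<close>, so \<open>P\<close> and
    \<open>N\<close> are its values for \<open>p\<close> and \<open>n\<close>. They need not be the
    positive and negative parts of \<open>I\<close>.\<close>
  define P where "P h = p (a h) / a h + p (b h) / - b h" for h
  define N where "N h = n (a h) / a h + n (b h) / - b h" for h
  have [measurable]: "a \<in> borel_measurable ?R" "b \<in> borel_measurable ?R"
    unfolding a_def b_def by (rule x_plus_measurable[OF X EX m] x_minus_measurable[OF X EX m])+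
  have [measurable]: "p \<in> borel_measurable borel" "n \<in> borel_measurable borel"
    unfolding p_def n_def by measurable
  have PN_measurable [measurable]: "P \<in> borel_measurable ?R" "N \<in> borel_measurable ?R"
    unfolding P_def N_def by measurable
  have pn: "0 \<le> p x" "0 \<le> n x" "g x = p x - n x" "p 0 = 0" "n 0 = 0" for x
    using assms(9) by (auto simp: p_def n_def max_def)
  have ab: "0 < a h" "b h < 0" if "h \<in> space ?R" for h
    using that x_plus_real(2)[OF X EX m] x_minus_real_neg[OF X EX m]
    by (auto simp: a_def b_def space_restrict_space)
  have I_eq: "I h = P h - N h" if "h \<in> space ?R" for h
    using two_point_expectation_ratio[OF ab[OF that], of g]
    by (simp add: I_def X_law_def P_def N_def pn(3) diff_divide_distrib flip: a_def b_def)
  have PN_nonneg: "0 \<le> P h" "0 \<le> N h" if "h \<in> space ?R" for h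
    using pn(1,2) ab[OF that] unfolding P_def N_def
    by (auto intro!: add_nonneg_nonneg divide_nonneg_pos simp del: divide_minus_right)
  have int_P: "(\<integral>\<^sup>+h. P h \<partial>?R) = (\<integral>\<^sup>+\<omega>. p (X \<omega>) \<partial>M)"
    unfolding P_def a_def b_def by (rule nn_integral_two_sided[OF X EX m]) (auto simp: pn)
  have int_N: "(\<integral>\<^sup>+h. N h \<partial>?R) = (\<integral>\<^sup>+\<omega>. n (X \<omega>) \<partial>M)"
    unfolding N_def a_def b_def by (rule nn_integral_two_sided[OF X EX m]) (auto simp: pn)
  \<comment> \<open>Constants have finite integral over a probability space, so a one-sided bound on
    \<open>g\<close> makes the integral of \<open>n\<close> or of \<open>p\<close> finite.\<close>
  have bounded: "(\<integral>\<^sup>+\<omega>. f (X \<omega>) \<partial>M) < \<infinity>" if "\<And>x. f x \<le> c" for f :: "real \<Rightarrow> real" and c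
  proof -
    have "(\<integral>\<^sup>+\<omega>. f (X \<omega>) \<partial>M) \<le> (\<integral>\<^sup>+\<omega>. c \<partial>M)"
      using that by (intro nn_integral_mono ennreal_leI)
    also have "\<dots> < \<infinity>"
      by (simp add: emeasure_space_1)
    finally show ?thesis .
  qed
  have fin: "(\<integral>\<^sup>+\<omega>. p (X \<omega>) \<partial>M) < \<infinity> \<or> (\<integral>\<^sup>+\<omega>. n (X \<omega>) \<partial>M) < \<infinity>"
    using assms(8)
  proof
    assume "bdd_below (range g)"
    then obtain c where c: "\<And>x. c \<le> g x"
      by (auto simp: bdd_below_def)
    have "n x \<le> max 0 (- c)" for x
      using c[of x] by (auto simp: n_def max_def)
    then show ?thesis
      using bounded by blast
  next
    assume "bdd_above (range g)"
    then obtain c where c: "\<And>x. g x \<le> c"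
      by (auto simp: bdd_above_def)
    have "p x \<le> max 0 c" for x
      using c[of x] by (auto simp: p_def max_def)
    then show ?thesis
      using bounded by blast
  qed
  \<comment> \<open>\<open>I\<close> is built from a family of laws depending on \<open>h\<close>;
    its measurability is read off from the explicit formula valid on \<open>(0, m)\<close>.\<close>
  have "I \<in> borel_measurable ?R \<longleftrightarrow> (\<lambda>h. P h - N h) \<in> borel_measurable ?R"
    by (rule measurable_cong) (rule I_eq)
  then have I_meas: "I \<in> borel_measurable ?R"
    by simp
  have gX: "quasi_integrable M (\<lambda>\<omega>. g (X \<omega>))"
    "ext_integral M (\<lambda>\<omega>. g (X \<omega>))
       = enn2ereal (\<integral>\<^sup>+\<omega>. p (X \<omega>) \<partial>M) - enn2ereal (\<integral>\<^sup>+\<omega>. n (X \<omega>) \<partial>M)"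
    by (rule ext_integral_diff; use fin in \<open>simp add: pn\<close>)+
  have I: "quasi_integrable ?R I"
    "ext_integral ?R I = enn2ereal (\<integral>\<^sup>+h. P h \<partial>?R) - enn2ereal (\<integral>\<^sup>+h. N h \<partial>?R)"
    by (rule ext_integral_diff[OF I_meas PN_measurable I_eq PN_nonneg];
        use fin in \<open>simp add: int_P int_N\<close>)+
  show ?thesis
    using gX I unfolding I_def by (simp add: Let_def int_P int_N)
qed

end
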